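(* For every integer $n\ge2$, the family $\mathscr D^{\infty}_{tqp}(n)$ of transcendentally $n$-quasiperiodic sets at infinity and the family $\mathscr D^{\infty}_{aqp}(n)$ of algebraically $n$-quasiperiodic sets at infinity are both infinite.
   Context: A finite set of real numbers is rationally (resp. algebraically) independent if it is linearly independent over the field $\mathbb{Q}$ of rational numbers (resp. over the field of real algebraic numbers); otherwise it is rationally (resp. algebraically) dependent. For an integer $n\ge2$, a function $G\colon\mathbb{R}\to\mathbb{R}$ is $n$-quasiperiodic if $G(\tau)=H(\tau,\dots,\tau)$ for some $H\colon\mathbb{R}^n\to\mathbb{R}$ which, for each $k=1,\dots,n$, is nonconstant and periodic in its $k$-th component with minimal period $T_k>0$, where the quasiperiods $T_1,\dots,T_n$ are rationally independent. $G$ is transcendentally $n$-quasiperiodic if $T_1,\dots,T_n$ are moreover algebraically independent, and algebraically $n$-quasiperiodic if $T_1,\dots,T_n$ are rationally independent but algebraically dependent. (Example: $G(\tau)=\lambda_1G_1(\tau+\nu_1)+\lambda_2G_2(\tau+\nu_2)$ with $\lambda_i\neq0$ and $G_i$ nonconstant with minimal period $T_i$ is algebraically (resp. transcendentally) $2$-quasiperiodic if $T_1/T_2$ is an irrational algebraic (resp. a transcendental) number.) For $\Omega\subseteq\mathbb{R}^N$ and $t>0$ let ${}_t\Omega:=B_t(0)^c\cap\Omega$, where $B_t(0)$ is the open Euclidean ball of radius $t$ centered at $0$, and let $|\cdot|$ be $N$-dimensional Lebesgue measure. A Lebesgue measurable set $\Omega\subseteq\mathbb{R}^N$ of finite Lebesgue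 measure is (transcendentally, resp. algebraically) $n$-quasiperiodic at infinity if there are a constant $D\in(-\infty,-N]$ and a nonnegative function $G\colon\mathbb{R}\to\mathbb{R}$ with $0<\liminf_{\tau\to+\infty}G(\tau)\le\limsup_{\tau\to+\infty}G(\tau)<+\infty$ such that $$|{}_t\Omega|=t^{N+D}\bigl(G(\log t)+o(1)\bigr)\quad\text{as }t\to+\infty$$ and $G$ is (transcendentally, resp. algebraically) $n$-quasiperiodic. *)

theory Defs
  imports
    "HOL-Analysis.Analysis"
    "HOL-Computational_Algebra.Polynomial"
    "HOL-Library.Landau_Symbols"
    "HOL-Library.Periodic_Fun"
begin

text \<open>Linear independence of a finite set of reals over a subfield \<^term>\<open>K\<close> of the reals.\<close>
definition independent_over :: "real set \<Rightarrow> real set \<Rightarrow> bool" where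
  "independent_over K S \<longleftrightarrow>
     (\<forall>c. (\<forall>x\<in>S. c x \<in> K) \<and> (\<Sum>x\<in>S. c x * x) = 0 \<longrightarrow> (\<forall>x\<in>S. c x = 0))"

definition rationally_independent :: "real set \<Rightarrow> bool" where
  "rationally_independent S \<longleftrightarrow> finite S \<and> independent_over \<rat> S"

text \<open>This is linear independence over the field of real algebraic numbers, not
  algebraic independence in the sense of field theory.\<close>
definition algebraically_independent :: "real set \<Rightarrow> bool" where
  "algebraically_independent S \<longleftrightarrow> finite S \<and> independent_over {x. algebraic x} S"

definition minimal_period :: "(real \<Rightarrow> real) \<Rightarrow> real \<Rightarrow> bool" where
  "minimal_period f T \<longleftrightarrow>
     T > 0 \<and> periodic_fun_simple f T \<and> (\<forall>T'>0. periodic_fun_simple f T' \<longrightarrow> T \<le> T')"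

text \<open>\<open>\<real>\<^sup>n\<close> is represented by the extensional functions \<^term>\<open>{1..n} \<rightarrow>\<^sub>E (UNIV :: real set)\<close>.
  The conditions on the \<open>k\<close>-th component are imposed on the map \<open>s \<mapsto> H (x(k := s))\<close> for
  every choice \<open>x\<close> of the remaining components. Injectivity of \<open>T\<close> says that the quasiperiods
  form an \<open>n\<close>-element set, since independence is a property of the set
  and does not see repetitions.\<close>
definition quasiperiodic_with :: "nat \<Rightarrow> (nat \<Rightarrow> real) \<Rightarrow> (real \<Rightarrow> real) \<Rightarrow> bool" where
  "quasiperiodic_with n T G \<longleftrightarrow>
     inj_on T {1..n} \<and> rationally_independent (T ` {1..n}) \<and>
     (\<exists>H :: (nat \<Rightarrow> real) \<Rightarrow> real.
        (\<forall>\<tau>. G \<tau> = H (\<lambda>k\<in>{1..n}. \<tau>)) \<and>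
        (\<forall>k\<in>{1..n}. \<forall>x\<in>{1..n} \<rightarrow>\<^sub>E UNIV.
           \<not> (\<lambda>s. H (x(k := s))) constant_on UNIV \<and>
           minimal_period (\<lambda>s. H (x(k := s))) (T k)))"

definition transcendentally_quasiperiodic :: "nat \<Rightarrow> (real \<Rightarrow> real) \<Rightarrow> bool" where
  "transcendentally_quasiperiodic n G \<longleftrightarrow>
     (\<exists>T. quasiperiodic_with n T G \<and> algebraically_independent (T ` {1..n}))"

definition algebraically_quasiperiodic :: "nat \<Rightarrow> (real \<Rightarrow> real) \<Rightarrow> bool" where
  "algebraically_quasiperiodic n G \<longleftrightarrow>
     (\<exists>T. quasiperiodic_with n T G \<and> \<not> algebraically_independent (T ` {1..n}))"

text \<open>\<open>Q\<close> is the kind of quasiperiodicity required of \<open>G\<close>.\<close>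
definition at_infinity_with ::
    "((real \<Rightarrow> real) \<Rightarrow> bool) \<Rightarrow> (real ^ 'N) set \<Rightarrow> bool" where
  "at_infinity_with Q \<Omega> \<longleftrightarrow>
     \<Omega> \<in> lmeasurable \<and>
     (\<exists>D G. D \<le> - real CARD('N) \<and> (\<forall>\<tau>. 0 \<le> G \<tau>) \<and>
        0 < Liminf at_top (\<lambda>\<tau>. ereal (G \<tau>)) \<and>
        Liminf at_top (\<lambda>\<tau>. ereal (G \<tau>)) \<le> Limsup at_top (\<lambda>\<tau>. ereal (G \<tau>)) \<and>
        Limsup at_top (\<lambda>\<tau>. ereal (G \<tau>)) < \<infinity> \<and>
        (\<exists>\<epsilon> :: real \<Rightarrow> real. \<epsilon> \<in> o[at_top](\<lambda>_. 1) \<and>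
           (\<forall>\<^sub>F t in at_top.
              measure lebesgue (- ball 0 t \<inter> \<Omega>)
                = t powr (real CARD('N) + D) * (G (ln t) + \<epsilon> t))) \<and>
        Q G)"

definition D_tqp_infinity :: "nat \<Rightarrow> (real ^ 'N) set set" where
  "D_tqp_infinity n = {\<Omega>. at_infinity_with (transcendentally_quasiperiodic n) \<Omega>}"

definition D_aqp_infinity :: "nat \<Rightarrow> (real ^ 'N) set set" where
  "D_aqp_infinity n = {\<Omega>. at_infinity_with (algebraically_quasiperiodic n) \<Omega>}"

end

theory Submission
  imports Defs
begin

text \<open>
  Tails of sets can be prescribed: if \<open>F\<close> decreases to \<open>0\<close>, fill from each shell
  \<open>k \<le> |x| < k + 1\<close> an annulus of volume \<open>F k - F (k + 1)\<close>. Far out the shells have room for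
  this, and by telescoping the part of the set outside the ball of radius \<open>k\<close> has volume exactly
  \<open>F k\<close>. For \<open>F t = G (ln t) / t\<close> with a bounded Lipschitz function \<open>G\<close>, the values of \<open>F\<close> at
  consecutive integers differ by \<open>O(1/t\<^sup>2)\<close>, so that passing from integers to real \<open>t\<close> costs only
  an error \<open>o(1)\<close> in \<open>G\<close>. This realizes the profile \<open>G\<close> with \<open>N + D = -1\<close>
  (\<open>ex_set_with_lipschitz_profile\<close>).

  The requirement that \<open>F\<close> be decreasing is harmless: adding a large constant to \<open>G\<close> makes
  \<open>G\<close> exceed its Lipschitz constant, and then \<open>exp (-\<tau>) * G \<tau>\<close> decreases. So one may take
  \<open>G \<tau> = C + (\<Sum>k=1..n. sin (2 * pi * \<tau> / T k))\<close>, which is quasiperiodic with any prescribed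
  independent quasiperiods \<open>T 1, \<dots>, T n\<close>.

  The quasiperiods exist by counting. Given a countable set \<open>K\<close> of coefficients and finitely many
  independent reals, only countably many reals depend on them, so the family can be prolonged by
  another positive number (\<open>independent_over_extend\<close>). Starting from the empty family over the
  real algebraic numbers gives the transcendental case; starting from \<open>1, sqrt 2\<close> over the
  rationals gives the algebraic case, because these two numbers already satisfy a linear relation
  with algebraic coefficients.

  Finally, only the tail of a set matters, so that one set in either family yields infinitely many
  by changing it inside the unit ball (\<open>infinite_at_infinity_with\<close>).
\<close>

section \<open>Quasiperiods by a counting argument\<close>

lemma independent_over_mono:
  assumes "independent_over L S" and "K \<subseteq> L"
  shows "independent_over K S"
  using assms unfolding independent_over_def by blast

lemma countable_int_polys: "countable (UNIV :: int poly set)"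
proof -
  have "UNIV = range (Poly :: int list \<Rightarrow> int poly)"
    by (metis Poly_coeffs surj_def)
  then show ?thesis
    by (metis countable_image countableI_type)
qed

lemma countable_algebraic_reals: "countable {x::real. algebraic x}"
proof -
  have "{x::real. algebraic x} \<subseteq> (\<Union>p\<in>UNIV - {0}. {x. poly (map_poly of_int p) x = 0})"
    by (auto elim!: algebraicE')
  moreover have "countable (\<Union>p\<in>UNIV - {0::int poly}. {x::real. poly (map_poly of_int p) x = 0})"
  proof (intro countable_UN)
    show "countable (UNIV - {0::int poly})"
      using countable_int_polys countable_subset by blast
    show "countable {x::real. poly (map_poly of_int p) x = 0}" if "p \<in> UNIV - {0}" for p :: "int poly"
      using that by (intro countable_finite poly_roots_finite) (simp add: map_poly_eq_0_iff)
  qed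
  ultimately show ?thesis
    by (rule countable_subset)
qed

text \<open>If \<open>v\<close> is dependent on an independent finite set \<open>S\<close>, it is a quotient of a combination of
  \<open>S\<close> by a coefficient in \<open>K\<close>. There are countably many such quotients, so that some
  \<open>v\<close> in an interval avoids them.\<close>
lemma independent_over_extend:
  assumes K: "countable K" and S: "finite S" "independent_over K S"
  obtains v where "v > 0" "v \<notin> S" "independent_over K (insert v S)"
proof -
  define B where
    "B = (\<lambda>(f, a). - (\<Sum>x\<in>S. f x * x) / a) ` ((S \<rightarrow>\<^sub>E K) \<times> K)"
  have "countable (B \<union> S)"
    unfolding B_def using K S by (intro countable_Un countable_image countable_SIGMA countable_PiE)
      (auto intro: countable_finite)
  moreover have "uncountable {0<..<1::real}"
    by (simp add: uncountable_open_interval)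
  ultimately have "\<not> {0<..<1} \<subseteq> B \<union> S"
    using countable_subset[of "{0<..<1}" "B \<union> S"] by blast
  then obtain v where v: "v \<in> {0<..<1}" "v \<notin> B \<union> S"
    by blast
  have "independent_over K (insert v S)"
    unfolding independent_over_def
  proof (intro allI impI, elim conjE)
    fix c assume cK: "\<forall>x\<in>insert v S. c x \<in> K" and "(\<Sum>x\<in>insert v S. c x * x) = 0"
    then have eq: "c v * v + (\<Sum>x\<in>S. c x * x) = 0"
      using S v by simp
    have "c v = 0"
    proof (rule ccontr)
      assume "c v \<noteq> 0"
      then have "v = - (\<Sum>x\<in>S. restrict c S x * x) / c v"
        using eq by (simp add: field_simps)
      moreover have "(restrict c S, c v) \<in> (S \<rightarrow>\<^sub>E K) \<times> K"
        using cK by auto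
      ultimately have "v \<in> B"
        unfolding B_def by (auto intro!: image_eqI[where x = "(restrict c S, c v)"])
      then show False using v by simp
    qed
    then show "\<forall>x\<in>insert v S. c x = 0"
      using eq cK S(2) unfolding independent_over_def by auto
  qed
  then show thesis using v that by auto
qed

lemma independent_over_extend_to_card:
  assumes K: "countable K" and S: "finite S" "independent_over K S" "S \<subseteq> {0<..}" and "card S \<le> n"
  obtains S' where "S \<subseteq> S'" "finite S'" "card S' = n" "independent_over K S'" "S' \<subseteq> {0<..}"
proof -
  have "\<exists>S'. S \<subseteq> S' \<and> finite S' \<and> card S' = n \<and> independent_over K S' \<and> S' \<subseteq> {0<..}"
    using \<open>card S \<le> n\<close>
  proof (induction n rule: dec_induct)
    case base
    then show ?case using S by blast
  next
    case (step m)
    then obtain S' where S': "S \<subseteq> S'" "finite S'" "card S' = m" "independent_over K S'" "S' \<subseteq> {0<..}"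
      by blast
    obtain v where "v > 0" "v \<notin> S'" "independent_over K (insert v S')"
      using independent_over_extend[OF K S'(2,4)] .
    with S' show ?case by (intro exI[of _ "insert v S'"]) auto
  qed
  then show thesis using that by blast
qed

text \<open>A rational algebraic integer is an integer, and there is none strictly between
  \<open>1\<close> and \<open>2\<close>.\<close>
lemma sqrt_2_irrational: "sqrt 2 \<notin> \<rat>"
proof
  assume "sqrt 2 \<in> \<rat>"
  moreover have "algebraic_int (sqrt 2)"
    by (intro algebraic_int_sqrt) simp
  ultimately obtain m :: int where m: "sqrt 2 = of_int m"
    using rational_algebraic_int_is_int by (auto elim: Ints_cases)
  have "1 < sqrt 2" "sqrt 2 < 2"
    by (auto simp: real_less_lsqrt)
  then show False
    unfolding m by simp
qed

lemma independent_over_rats_1_sqrt_2: "independent_over \<rat> {1, sqrt 2}"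
  unfolding independent_over_def
proof (intro allI impI, elim conjE)
  fix c assume cQ: "\<forall>x\<in>{1, sqrt 2}. c x \<in> \<rat>" and "(\<Sum>x\<in>{1, sqrt 2}. c x * x) = 0"
  then have eq: "c 1 + c (sqrt 2) * sqrt 2 = 0" by simp
  have "c (sqrt 2) = 0"
  proof (rule ccontr)
    assume "c (sqrt 2) \<noteq> 0"
    then have "sqrt 2 = - c 1 / c (sqrt 2)" using eq by (simp add: field_simps)
    moreover have "- c 1 / c (sqrt 2) \<in> \<rat>" using cQ by (intro Rats_divide Rats_minus_iff[THEN iffD2]) auto
    ultimately show False using sqrt_2_irrational by simp
  qed
  with eq show "\<forall>x\<in>{1, sqrt 2}. c x = 0" by simp
qed

text \<open>The relation is \<open>(- sqrt 2) * 1 + 1 * sqrt 2 = 0\<close>.\<close>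
lemma not_algebraically_independent_if_1_sqrt_2:
  assumes "{1, sqrt 2} \<subseteq> S"
  shows "\<not> algebraically_independent S"
proof
  assume indep: "algebraically_independent S"
  define c where "c x = (if x = 1 then - sqrt 2 else if x = sqrt 2 then 1 else 0)" for x :: real
  have "finite S" using indep by (simp add: algebraically_independent_def)
  then have "(\<Sum>x\<in>S. c x * x) = (\<Sum>x\<in>{1, sqrt 2}. c x * x)"
    using assms by (intro sum.mono_neutral_right) (auto simp: c_def)
  also have "\<dots> = 0" by (simp add: c_def)
  finally have "(\<Sum>x\<in>S. c x * x) = 0" .
  moreover have "\<forall>x\<in>S. c x \<in> {x. algebraic x}"
    by (auto simp: c_def intro: algebraic_sqrt)
  ultimately have "\<forall>x\<in>S. c x = 0"
    using indep unfolding algebraically_independent_def independent_over_def by blast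
  then have "c 1 = 0" using assms by blast
  then show False by (simp add: c_def)
qed

lemma algebraically_independent_imp_rationally_independent:
  assumes "algebraically_independent S"
  shows "rationally_independent S"
proof -
  have "\<rat> \<subseteq> {x::real. algebraic x}"
    using rat_imp_algebraic by blast
  then show ?thesis
    using assms independent_over_mono
    unfolding algebraically_independent_def rationally_independent_def by blast
qed

lemma finite_set_enumeration:
  assumes "finite S" "card S = n"
  obtains T where "inj_on T {1..n}" "T ` {1..n} = S"
  using ex_bij_betw_nat_finite_1[OF assms(1)] assms(2) unfolding bij_betw_def by blast

lemma ex_algebraically_independent_quasiperiods:
  obtains T :: "nat \<Rightarrow> real" where
    "inj_on T {1..n}" "T ` {1..n} \<subseteq> {0<..}" "algebraically_independent (T ` {1..n})"
proof -
  obtain S where "finite S" "card S = n" "independent_over {x. algebraic x} S" "S \<subseteq> {0<..}"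
    using independent_over_extend_to_card[OF countable_algebraic_reals, of "{}" n]
    by (auto simp: independent_over_def)
  moreover then obtain T where "inj_on T {1..n}" "T ` {1..n} = S"
    using finite_set_enumeration by metis
  ultimately show thesis
    using that by (simp add: algebraically_independent_def)
qed

lemma ex_only_rationally_independent_quasiperiods:
  assumes "n \<ge> 2"
  obtains T :: "nat \<Rightarrow> real" where
    "inj_on T {1..n}" "T ` {1..n} \<subseteq> {0<..}" "rationally_independent (T ` {1..n})"
    "\<not> algebraically_independent (T ` {1..n})"
proof -
  obtain S where S: "{1, sqrt 2} \<subseteq> S" "finite S" "card S = n" "independent_over \<rat> S" "S \<subseteq> {0<..}"
  proof (rule independent_over_extend_to_card)
    show "countable (\<rat> :: real set)" by (rule countable_rat)
    show "independent_over \<rat> {1, sqrt 2}" by (rule independent_over_rats_1_sqrt_2)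
    show "card {1, sqrt 2} \<le> n" using assms by simp
  qed auto
  obtain T where "inj_on T {1..n}" "T ` {1..n} = S"
    using finite_set_enumeration[OF S(2,3)] .
  then show thesis
    using that S not_algebraically_independent_if_1_sqrt_2[OF S(1)]
    by (simp add: rationally_independent_def)
qed


section \<open>A sum of sines is quasiperiodic\<close>

lemma minimal_period_sin:
  assumes "T > 0"
  shows "minimal_period (\<lambda>s. C + sin (2 * pi * s / T)) T"
  unfolding minimal_period_def
proof (intro conjI allI impI)
  show "periodic_fun_simple (\<lambda>s. C + sin (2 * pi * s / T)) T"
    using assms by unfold_locales (simp add: distrib_left add_divide_distrib)
  fix T' :: real assume "T' > 0" and per: "periodic_fun_simple (\<lambda>s. C + sin (2 * pi * s / T)) T'"
  \<comment> \<open>The sine attains its maximum at a quarter of the period; the shift by \<open>T'\<close> must attain it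
    again.\<close>
  have "sin (2 * pi * (T / 4 + T') / T) = sin (2 * pi * (T / 4) / T)"
    using periodic_fun_simple.plus_period[OF per, of "T / 4"] by simp
  moreover have "2 * pi * (T / 4 + T') / T = pi / 2 + 2 * pi * T' / T" "2 * pi * (T / 4) / T = pi / 2"
    using assms by (simp_all add: field_simps)
  ultimately have "sin (pi / 2 + 2 * pi * T' / T) = sin (pi / 2)"
    by (simp only:)
  then have "cos (2 * pi * T' / T) = 1"
    by (simp add: sin_add)
  then obtain m :: int where "2 * pi * T' / T = of_int m * 2 * pi"
    unfolding cos_one_2pi_int by blast
  then have T': "T' = of_int m * T"
    using assms by (simp add: field_simps)
  then have "m \<ge> 1"
    using \<open>T' > 0\<close> assms by (simp add: zero_less_mult_iff)
  then show "T \<le> T'"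
    using T' assms mult_right_mono[of 1 "real_of_int m" T] by simp
qed (use assms in auto)

definition sine_sum :: "nat \<Rightarrow> (nat \<Rightarrow> real) \<Rightarrow> real \<Rightarrow> (nat \<Rightarrow> real) \<Rightarrow> real" where
  "sine_sum n T C x = C + (\<Sum>k\<in>{1..n}. sin (2 * pi * x k / T k))"

text \<open>In each single variable the sum is a sine plus a constant, which is why the behaviour of one
  sine decides the quasiperiodicity.\<close>
lemma sine_sum_update:
  assumes "k \<in> {1..n}"
  shows "sine_sum n T C (x(k := s)) =
    (C + (\<Sum>j\<in>{1..n} - {k}. sin (2 * pi * x j / T j))) + sin (2 * pi * s / T k)"
proof -
  have "(\<Sum>j\<in>{1..n}. sin (2 * pi * (x(k := s)) j / T j)) =
      sin (2 * pi * s / T k) + (\<Sum>j\<in>{1..n} - {k}. sin (2 * pi * (x(k := s)) j / T j))"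
    using assms by (subst sum.remove[of _ k]) auto
  also have "(\<Sum>j\<in>{1..n} - {k}. sin (2 * pi * (x(k := s)) j / T j)) =
      (\<Sum>j\<in>{1..n} - {k}. sin (2 * pi * x j / T j))"
    by (intro sum.cong) auto
  finally show ?thesis
    by (simp add: sine_sum_def)
qed

lemma quasiperiodic_sine_sum:
  assumes "inj_on T {1..n}" "T ` {1..n} \<subseteq> {0<..}" "rationally_independent (T ` {1..n})"
  shows "quasiperiodic_with n T (\<lambda>\<tau>. sine_sum n T C (\<lambda>k. \<tau>))"
  unfolding quasiperiodic_with_def
proof (intro conjI exI[of _ "sine_sum n T C"] allI ballI)
  fix k and x :: "nat \<Rightarrow> real"
  assume k: "k \<in> {1..n}"
  then have "T k > 0" using assms(2) by (simp add: image_subset_iff)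
  let ?c = "C + (\<Sum>j\<in>{1..n} - {k}. sin (2 * pi * x j / T j))"
  have upd: "(\<lambda>s. sine_sum n T C (x(k := s))) = (\<lambda>s. ?c + sin (2 * pi * s / T k))"
    using k by (simp add: sine_sum_update)
  show "minimal_period (\<lambda>s. sine_sum n T C (x(k := s))) (T k)"
    unfolding upd using \<open>T k > 0\<close> by (rule minimal_period_sin)
  have "sin (2 * pi * (T k / 4) / T k) = 1"
    using \<open>T k > 0\<close> sin_pi_half by (simp add: field_simps)
  then have neq: "?c + sin (2 * pi * 0 / T k) \<noteq> ?c + sin (2 * pi * (T k / 4) / T k)"
    by simp
  show "\<not> (\<lambda>s. sine_sum n T C (x(k := s))) constant_on UNIV"
  proof
    assume "(\<lambda>s. sine_sum n T C (x(k := s))) constant_on UNIV"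
    then obtain y where "?c + sin (2 * pi * s / T k) = y" for s
      unfolding upd constant_on_def by blast
    then show False
      using neq by (simp only: simp_thms)
  qed
qed (use assms in \<open>auto simp: sine_sum_def intro: sum.cong\<close>)

lemma abs_sin_diff_le: "\<bar>sin x - sin y\<bar> \<le> \<bar>x - y :: real\<bar>"
proof -
  have "\<bar>sin x - sin y\<bar> = 2 * (\<bar>sin ((x - y) / 2)\<bar> * \<bar>cos ((x + y) / 2)\<bar>)"
    by (simp add: sin_diff_sin abs_mult)
  also have "\<dots> \<le> 2 * (\<bar>(x - y) / 2\<bar> * 1)"
    by (intro mult_left_mono mult_mono abs_sin_x_le_abs_x) auto
  finally show ?thesis by simp
qed

lemma sine_sum_diagonal_lipschitz:
  assumes "T ` {1..n} \<subseteq> {0<..}"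
  shows "\<bar>sine_sum n T C (\<lambda>k. \<tau>) - sine_sum n T C (\<lambda>k. \<sigma>)\<bar> \<le> (\<Sum>k\<in>{1..n}. 2 * pi / T k) * \<bar>\<tau> - \<sigma>\<bar>"
proof -
  have "\<bar>sine_sum n T C (\<lambda>k. \<tau>) - sine_sum n T C (\<lambda>k. \<sigma>)\<bar>
      \<le> (\<Sum>k\<in>{1..n}. \<bar>sin (2 * pi * \<tau> / T k) - sin (2 * pi * \<sigma> / T k)\<bar>)"
    by (simp add: sine_sum_def flip: sum_subtractf)
  also have "\<dots> \<le> (\<Sum>k\<in>{1..n}. 2 * pi / T k * \<bar>\<tau> - \<sigma>\<bar>)"
  proof (rule sum_mono)
    fix k assume "k \<in> {1..n}"
    then have "T k > 0" using assms by (simp add: image_subset_iff)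
    have "\<bar>sin (2 * pi * \<tau> / T k) - sin (2 * pi * \<sigma> / T k)\<bar> \<le> \<bar>2 * pi * \<tau> / T k - 2 * pi * \<sigma> / T k\<bar>"
      by (rule abs_sin_diff_le)
    also have "\<dots> = \<bar>2 * pi / T k * (\<tau> - \<sigma>)\<bar>"
      by (simp add: right_diff_distrib)
    also have "\<dots> = 2 * pi / T k * \<bar>\<tau> - \<sigma>\<bar>"
      using \<open>T k > 0\<close> by (simp add: abs_mult)
    finally show "\<bar>sin (2 * pi * \<tau> / T k) - sin (2 * pi * \<sigma> / T k)\<bar> \<le> 2 * pi / T k * \<bar>\<tau> - \<sigma>\<bar>" .
  qed
  finally show ?thesis by (simp add: sum_distrib_right)
qed

lemma sine_sum_bounds: "\<bar>sine_sum n T C x - C\<bar> \<le> n"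
proof -
  have "\<bar>\<Sum>k\<in>{1..n}. sin (2 * pi * x k / T k)\<bar> \<le> (\<Sum>k\<in>{1..n}. 1)"
    by (rule order_trans[OF sum_abs sum_mono]) simp
  then show ?thesis by (simp add: sine_sum_def)
qed


section \<open>Sets with a prescribed tail volume\<close>

text \<open>The shell between the radii \<open>k\<close> and \<open>k + 1\<close> has at least the volume of the unit ball, since
  \<open>(k + 1)\<^sup>d - k\<^sup>d \<ge> 1\<close>; hence every volume up to that one is reached by an inner annulus of it.\<close>
lemma ex_annulus_with_volume:
  fixes k :: nat
  assumes "0 \<le> m" "m \<le> unit_ball_vol DIM('a)"
  obtains A :: "'a::euclidean_space set" where
    "A \<in> lmeasurable" "measure lebesgue A = m" "A \<subseteq> ball 0 (Suc k) - ball 0 k"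
proof -
  let ?d = "DIM('a)" and ?c = "unit_ball_vol DIM('a)"
  define r where "r = root ?d (real k ^ ?d + m / ?c)"
  have c: "?c > 0" by simp
  have rd: "r ^ ?d = real k ^ ?d + m / ?c"
    unfolding r_def using assms by (intro real_root_pow_pos2) auto
  have "r \<ge> 0" unfolding r_def using assms by simp
  have "real k \<le> r"
    by (rule power_le_imp_le_base[of _ "?d - 1"]) (use rd \<open>r \<ge> 0\<close> assms in auto)
  have "k ^ ?d < Suc k ^ ?d"
    by (intro power_strict_mono) auto
  then have "real (k ^ ?d + 1) \<le> real (Suc k ^ ?d)"
    by (intro of_nat_mono) simp
  then have "real k ^ ?d + 1 \<le> real (Suc k) ^ ?d"
    by (simp only: of_nat_add of_nat_power of_nat_1)
  moreover have "m / ?c \<le> 1" using assms(2) c by (simp add: divide_le_eq_1)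
  ultimately have "r ^ ?d \<le> real (Suc k) ^ ?d"
    using rd by linarith
  then have "r \<le> Suc k"
    by (metis DIM_positive Suc_pred of_nat_0_le_iff power_le_imp_le_base)
  let ?A = "ball 0 r - ball 0 (real k) :: 'a set"
  have "measure lebesgue ?A = measure lebesgue (ball 0 r :: 'a set) - measure lebesgue (ball 0 (real k) :: 'a set)"
    using \<open>real k \<le> r\<close> by (intro measurable_measure_Diff) auto
  also have "\<dots> = ?c * (r ^ ?d - real k ^ ?d)"
    using \<open>r \<ge> 0\<close> by (simp add: content_ball right_diff_distrib)
  also have "\<dots> = m" using less_imp_neq[OF c] by (simp add: rd)
  finally have "measure lebesgue ?A = m" .
  moreover have "?A \<in> lmeasurable"
    by (intro fmeasurable.Diff) auto
  moreover have "?A \<subseteq> ball 0 (Suc k) - ball 0 k"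
    using \<open>r \<le> Suc k\<close> by auto
  ultimately show thesis using that by blast
qed

text \<open>The annulus in the \<open>k\<close>-th shell gets the volume \<open>F k - F (k + 1)\<close>, and the volumes
  telescope. The shells used begin where \<open>F\<close> has dropped below the volume of the unit ball, so
  that each of them has enough room.\<close>
lemma ex_set_with_integer_tails:
  fixes F :: "nat \<Rightarrow> real"
  assumes "decseq F" "F \<longlonglongrightarrow> 0"
  obtains \<Omega> :: "'a::euclidean_space set" where
    "\<Omega> \<in> lmeasurable" "\<forall>\<^sub>F k in sequentially. measure lebesgue (- ball 0 (real k) \<inter> \<Omega>) = F k"
proof -
  have F0: "F k \<ge> 0" for k
    using assms by (rule decseq_ge)
  have "\<forall>\<^sub>F k in sequentially. F k < unit_ball_vol DIM('a)"
    using assms(2) by (rule order_tendstoD) simp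
  then obtain K where K: "\<And>k. k \<ge> K \<Longrightarrow> F k \<le> unit_ball_vol DIM('a)"
    unfolding eventually_sequentially by (meson less_imp_le)
  define P where "P k A \<longleftrightarrow> A \<in> lmeasurable \<and> measure lebesgue A = F k - F (Suc k)
    \<and> A \<subseteq> ball 0 (Suc k) - ball 0 k" for k and A :: "'a set"
  have "\<exists>A. P k A" if "k \<ge> K" for k
  proof -
    have "0 \<le> F k - F (Suc k)" "F k - F (Suc k) \<le> unit_ball_vol DIM('a)"
      using decseq_SucD[OF assms(1), of k] K[OF that] F0[of "Suc k"] by auto
    then show ?thesis
      using ex_annulus_with_volume[where 'a = 'a and k = k] unfolding P_def by metis
  qed
  then obtain A where "\<And>k. k \<ge> K \<Longrightarrow> P k (A k)" by metis
  then have A: "A k \<in> lmeasurable" "measure lebesgue (A k) = F k - F (Suc k)"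
    "A k \<subseteq> ball 0 (Suc k) - ball 0 k" if "k \<ge> K" for k
    using that unfolding P_def by blast+
  have norm_A: "real k \<le> norm x \<and> norm x < real k + 1" if "x \<in> A k" "k \<ge> K" for x k
    using A(3)[OF that(2)] that(1) by (auto simp: add.commute)
  define \<Omega> where "\<Omega> = (\<Union>i. A (K + i))"
  have tail: "- ball 0 (real k) \<inter> \<Omega> = (\<Union>i. A (k + i))" if "k \<ge> K" for k
  proof (intro equalityI subsetI)
    fix x assume "x \<in> - ball 0 (real k) \<inter> \<Omega>"
    then obtain i where i: "x \<in> A (K + i)" and "norm x \<ge> k"
      by (auto simp: \<Omega>_def not_less)
    then have "k \<le> K + i"
      using norm_A[OF i] by linarith
    then show "x \<in> (\<Union>i. A (k + i))"
      using i by (intro UN_I[of "K + i - k"]) auto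
  next
    fix x assume "x \<in> (\<Union>i. A (k + i))"
    then obtain i where i: "x \<in> A (k + i)" by blast
    then have "norm x \<ge> k"
      using norm_A[OF i] that by simp
    moreover have "x \<in> \<Omega>"
      unfolding \<Omega>_def using i that by (intro UN_I[of "k + i - K"]) auto
    ultimately show "x \<in> - ball 0 (real k) \<inter> \<Omega>" by auto
  qed
  have emeasure_tail: "emeasure lebesgue (\<Union>i. A (k + i)) = ennreal (F k)" if "k \<ge> K" for k
  proof -
    have "disjoint_family (\<lambda>i. A (k + i))"
      unfolding disjoint_family_on_def
    proof (intro ballI impI)
      fix i j :: nat assume "i \<noteq> j"
      show "A (k + i) \<inter> A (k + j) = {}"
      proof (intro equals0I, elim IntE)
        fix x assume "x \<in> A (k + i)" "x \<in> A (k + j)"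
        then show False
          using norm_A[of x "k + i"] norm_A[of x "k + j"] that \<open>i \<noteq> j\<close> by linarith
      qed
    qed
    moreover have "range (\<lambda>i. A (k + i)) \<subseteq> sets lebesgue"
      using A(1) that by (auto intro: fmeasurableD)
    ultimately have "emeasure lebesgue (\<Union>i. A (k + i)) = (\<Sum>i. emeasure lebesgue (A (k + i)))"
      by (intro suminf_emeasure[symmetric])
    also have "\<dots> = (\<Sum>i. ennreal (F (k + i) - F (Suc (k + i))))"
      using A(1,2) that by (simp add: emeasure_eq_measure2)
    also have "\<dots> = ennreal (F k)"
    proof (rule suminf_ennreal_eq)
      show "0 \<le> F (k + i) - F (Suc (k + i))" for i
        using decseq_SucD[OF assms(1), of "k + i"] by simp
      have "(\<lambda>i. F (k + i)) \<longlonglongrightarrow> 0"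
        using LIMSEQ_ignore_initial_segment[OF assms(2), of k] by (simp add: add.commute)
      then show "(\<lambda>i. F (k + i) - F (Suc (k + i))) sums F k"
        using telescope_sums'[of "\<lambda>i. F (k + i)" 0] by simp
    qed
    finally show ?thesis .
  qed
  have "\<Omega> \<in> lmeasurable"
    unfolding \<Omega>_def
  proof (rule fmeasurableI)
    show "(\<Union>i. A (K + i)) \<in> sets lebesgue"
      using A(1) by (auto intro!: sets.countable_UN' fmeasurableD)
    show "emeasure lebesgue (\<Union>i. A (K + i)) < \<infinity>"
      by (simp add: emeasure_tail)
  qed
  moreover have "\<forall>\<^sub>F k in sequentially. measure lebesgue (- ball 0 (real k) \<inter> \<Omega>) = F k"
    using eventually_ge_at_top[of K]
    by eventually_elim (simp add: tail emeasure_tail measure_def F0)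
  ultimately show thesis
    by (rule that)
qed

text \<open>This is \<open>G' \<le> L \<le> G\<close> in integrated form: \<open>exp (-\<tau>) * G \<tau>\<close> has derivative
  \<open>exp (-\<tau>) * (G' \<tau> - G \<tau>) \<le> 0\<close>, here without differentiability and in the variable
  \<open>t = exp \<tau>\<close>.\<close>
lemma lipschitz_profile_decreasing:
  fixes G :: "real \<Rightarrow> real"
  assumes lip: "\<And>\<tau> \<sigma>. \<bar>G \<tau> - G \<sigma>\<bar> \<le> L * \<bar>\<tau> - \<sigma>\<bar>" and L: "\<And>\<tau>. L \<le> G \<tau>"
    and st: "0 < s" "s \<le> t"
  shows "G (ln t) / t \<le> G (ln s) / s"
proof -
  have "0 \<le> L"
    using lip[of 1 0] by simp
  have "G (ln t) - G (ln s) \<le> L * (ln t - ln s)"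
    using lip[of "ln t" "ln s"] st by simp
  also have "\<dots> \<le> G (ln s) * ((t - s) / s)"
    using L[of "ln s"] \<open>0 \<le> L\<close> st ln_diff_le[of t s] by (intro mult_mono) auto
  finally have "G (ln t) \<le> G (ln s) * t / s"
    using st by (simp add: field_simps)
  then show ?thesis
    using st by (simp add: field_simps)
qed

text \<open>For \<open>k \<le> t < k + 1\<close> both the volume of the tail and \<open>G (ln t) / t\<close> lie between the values
  of the latter at \<open>k + 1\<close> and at \<open>k\<close>, because both are decreasing and agree at large integers.
  The gap between these values, times \<open>t\<close>, is at most \<open>(M + L) / k\<close>.\<close>
lemma ex_set_with_lipschitz_profile:
  fixes G :: "real \<Rightarrow> real"
  assumes lip: "\<And>\<tau> \<sigma>. \<bar>G \<tau> - G \<sigma>\<bar> \<le> L * \<bar>\<tau> - \<sigma>\<bar>"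
    and L: "\<And>\<tau>. L \<le> G \<tau>" and M: "\<And>\<tau>. G \<tau> \<le> M"
  obtains \<Omega> :: "'a::euclidean_space set" where
    "\<Omega> \<in> lmeasurable" "((\<lambda>t. t * measure lebesgue (- ball 0 t \<inter> \<Omega>) - G (ln t)) \<longlongrightarrow> 0) at_top"
proof -
  define F where "F t = G (ln t) / t" for t
  have F_mono: "F t \<le> F s" if "0 < s" "s \<le> t" for s t
    unfolding F_def using lip L that by (rule lipschitz_profile_decreasing)
  have "0 \<le> L"
    using lip[of 1 0] by simp
  have G0: "0 \<le> G \<tau>" for \<tau>
    using L[of \<tau>] \<open>0 \<le> L\<close> by simp
  have "0 \<le> M"
    using G0[of 0] M[of 0] by simp
  have lim_inverse: "((\<lambda>t. B / t) \<longlongrightarrow> 0) at_top" for B :: real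
    by (intro tendsto_divide_0[OF tendsto_const] filterlim_at_top_imp_at_infinity filterlim_ident)
  have "(F \<longlongrightarrow> 0) at_top"
  proof (rule tendsto_sandwich[OF _ _ tendsto_const lim_inverse[of M]])
    show "\<forall>\<^sub>F t in at_top. 0 \<le> F t"
      using eventually_gt_at_top[of 0] by eventually_elim (simp add: F_def G0)
    show "\<forall>\<^sub>F t in at_top. F t \<le> M / t"
      using eventually_gt_at_top[of 0] by eventually_elim (simp add: F_def M divide_right_mono)
  qed
  \<comment> \<open>The maximum keeps the sequence away from the default value \<open>F 0 = 0\<close>, which would break
    monotonicity.\<close>
  define f where "f k = F (max 1 (real k))" for k :: nat
  have "decseq f"
    unfolding f_def decseq_def by (auto intro!: F_mono)
  moreover have "f \<longlonglongrightarrow> 0"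
  proof (rule Lim_transform_eventually)
    show "(\<lambda>k. F (real k)) \<longlonglongrightarrow> 0"
      using filterlim_compose[OF \<open>(F \<longlongrightarrow> 0) at_top\<close> filterlim_real_sequentially] .
    show "\<forall>\<^sub>F k in sequentially. F (real k) = f k"
      using eventually_ge_at_top[of 1] by eventually_elim (simp add: f_def max_absorb2)
  qed
  ultimately obtain \<Omega> :: "'a set" where \<Omega>: "\<Omega> \<in> lmeasurable"
    and "\<forall>\<^sub>F k in sequentially. measure lebesgue (- ball 0 (real k) \<inter> \<Omega>) = f k"
    using ex_set_with_integer_tails by blast
  then obtain K where K: "\<And>k. k \<ge> K \<Longrightarrow> measure lebesgue (- ball 0 (real k) \<inter> \<Omega>) = f k"
    unfolding eventually_sequentially by blast
  define \<mu> where "\<mu> t = measure lebesgue (- ball 0 t \<inter> \<Omega>)" for t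
  have tail_lmeasurable: "- ball 0 t \<inter> \<Omega> \<in> lmeasurable" for t
    using fmeasurable_Int_fmeasurable[OF \<Omega>, of "- ball 0 t"] by (simp add: Int_commute)
  have \<mu>_mono: "\<mu> t \<le> \<mu> s" if "s \<le> t" for s t
    unfolding \<mu>_def using that
    by (intro measure_mono_fmeasurable fmeasurableD tail_lmeasurable) auto
  have error: "\<bar>t * \<mu> t - G (ln t)\<bar> \<le> (M + L) / (t - 1)" if t: "t > max 1 (real K) + 1" for t
  proof -
    define k where "k = nat \<lfloor>t\<rfloor>"
    have k: "real k \<le> t" "t < real k + 1" "k \<ge> 1" "k \<ge> K" "t - 1 < real k"
      using t unfolding k_def by linarith+
    have "\<mu> k = F k" "\<mu> (real k + 1) = F (real k + 1)"
      using K[of k] K[of "Suc k"] k by (auto simp: \<mu>_def f_def max_def add.commute)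
    then have "\<mu> t \<le> F k" "F (real k + 1) \<le> \<mu> t"
      using \<mu>_mono[of "real k" t] \<mu>_mono[of t "real k + 1"] k by auto
    moreover have "F t \<le> F k" "F (real k + 1) \<le> F t"
      using F_mono[of "real k" t] F_mono[of t "real k + 1"] k by auto
    ultimately have "\<bar>\<mu> t - F t\<bar> \<le> F k - F (real k + 1)"
      by linarith
    have "\<bar>t * \<mu> t - G (ln t)\<bar> = t * \<bar>\<mu> t - F t\<bar>"
    proof -
      have "t * \<mu> t - G (ln t) = t * (\<mu> t - F t)"
        using t by (simp add: F_def field_simps)
      then show ?thesis using t by (simp add: abs_mult)
    qed
    also have "\<dots> \<le> (real k + 1) * (F k - F (real k + 1))"
      using \<open>\<bar>\<mu> t - F t\<bar> \<le> F k - F (real k + 1)\<close> k t by (intro mult_mono) auto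
    also have "\<dots> = G (ln k) / k + (G (ln k) - G (ln (real k + 1)))"
    proof -
      have "(real k + 1) * F k = G (ln k) / k + G (ln k)"
        using k(3) by (simp add: F_def distrib_right add_divide_distrib)
      moreover have "(real k + 1) * F (real k + 1) = G (ln (real k + 1))"
        by (simp add: F_def)
      ultimately show ?thesis
        by (simp add: right_diff_distrib)
    qed
    also have "\<dots> \<le> M / k + L / k"
    proof (intro add_mono)
      show "G (ln k) / k \<le> M / k" by (simp add: M divide_right_mono)
      have "G (ln k) - G (ln (real k + 1)) \<le> L * (ln (real k + 1) - ln k)"
        using lip[of "ln k" "ln (real k + 1)"] k by simp
      also have "\<dots> \<le> L * (1 / k)"
        using ln_diff_le[of "real k + 1" "real k"] k \<open>0 \<le> L\<close> by (intro mult_left_mono) auto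
      finally show "G (ln k) - G (ln (real k + 1)) \<le> L / k" by simp
    qed
    also have "\<dots> = (M + L) / k" by (simp add: add_divide_distrib)
    also have "\<dots> \<le> (M + L) / (t - 1)"
      using k t \<open>0 \<le> M\<close> \<open>0 \<le> L\<close> by (intro divide_left_mono) auto
    finally show ?thesis .
  qed
  have "((\<lambda>t. t * \<mu> t - G (ln t)) \<longlongrightarrow> 0) at_top"
  proof (rule Lim_null_comparison)
    show "\<forall>\<^sub>F t in at_top. norm (t * \<mu> t - G (ln t)) \<le> (M + L) / (t - 1)"
      using eventually_gt_at_top[of "max 1 (real K) + 1"] by eventually_elim (use error in auto)
    show "((\<lambda>t. (M + L) / (t - 1)) \<longlongrightarrow> 0) at_top"
      using filterlim_compose[OF lim_inverse
          filterlim_tendsto_add_at_top[OF tendsto_const[of "-1"] filterlim_ident]]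
      by simp
  qed
  then show thesis
    using that \<Omega> unfolding \<mu>_def by blast
qed


section \<open>Quasiperiodic sets at infinity\<close>

lemma at_infinity_with_cong_tail:
  assumes "at_infinity_with Q \<Omega>" and "\<Omega>' \<in> lmeasurable" and "\<Omega>' - ball 0 r = \<Omega> - ball 0 r"
  shows "at_infinity_with Q \<Omega>'"
proof -
  have tail: "- ball 0 t \<inter> \<Omega>' = - ball 0 t \<inter> \<Omega>" if "r \<le> t" for t
    using assms(3) subset_ball[OF that, of 0] by blast
  have ev: "(\<forall>\<^sub>F t in at_top. measure lebesgue (- ball 0 t \<inter> \<Omega>') = g t) \<longleftrightarrow>
      (\<forall>\<^sub>F t in at_top. measure lebesgue (- ball 0 t \<inter> \<Omega>) = g t)" for g :: "real \<Rightarrow> real"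
    by (intro eventually_subst eventually_mono[OF eventually_ge_at_top[of r]]) (simp add: tail)
  show ?thesis
    using assms(1,2) unfolding at_infinity_with_def ev by simp
qed

text \<open>Replacing the part of \<open>\<Omega>\<close> in the unit ball by a concentric ball of radius \<open>s < 1\<close> does not
  change the tail, and different \<open>s\<close> give sets of different volume.\<close>
lemma infinite_at_infinity_with:
  fixes \<Omega> :: "(real ^ 'N) set"
  assumes "at_infinity_with Q \<Omega>"
  shows "infinite {\<Omega> :: (real ^ 'N) set. at_infinity_with Q \<Omega>}"
proof -
  define f where "f s = (\<Omega> - ball 0 1) \<union> ball 0 s" for s :: real
  have "inj_on f {0<..<1}"
  proof (rule inj_onI)
    fix s t :: real assume st: "s \<in> {0<..<1}" "t \<in> {0<..<1}" and eq: "f s = f t"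
    have core: "f u \<inter> ball 0 1 = ball 0 u" if "u \<in> {0<..<1}" for u
      using that by (auto simp: f_def)
    have "ball (0 :: real ^ 'N) s = ball 0 t"
      using core[OF st(1)] core[OF st(2)] eq by simp
    then show "s = t"
      using st by (simp add: ball_eq_ball_iff)
  qed
  then have "infinite (f ` {0<..<1})"
    by (simp add: finite_image_iff)
  moreover have "f ` {0<..<1} \<subseteq> {\<Omega>. at_infinity_with Q \<Omega>}"
  proof clarify
    fix s :: real assume s: "s \<in> {0<..<1}"
    have "\<Omega> \<in> lmeasurable"
      using assms by (simp add: at_infinity_with_def)
    then have "f s \<in> lmeasurable"
      unfolding f_def by (intro fmeasurable.Un fmeasurable.Diff) auto
    moreover have "f s - ball 0 1 = \<Omega> - ball 0 1"
      using s by (auto simp: f_def)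
    ultimately show "at_infinity_with Q (f s)"
      by (rule at_infinity_with_cong_tail[OF assms])
  qed
  ultimately show ?thesis
    using finite_subset by blast
qed

lemma ex_at_infinity_with_lipschitz:
  assumes lip: "\<And>\<tau> \<sigma>. \<bar>G \<tau> - G \<sigma>\<bar> \<le> L * \<bar>\<tau> - \<sigma>\<bar>"
    and L: "\<And>\<tau>. L \<le> G \<tau>" and M: "\<And>\<tau>. G \<tau> \<le> M" and G1: "\<And>\<tau>. 1 \<le> G \<tau>" and "Q G"
  shows "\<exists>\<Omega> :: (real ^ 'N) set. at_infinity_with Q \<Omega>"
proof -
  obtain \<Omega> :: "(real ^ 'N) set" where \<Omega>: "\<Omega> \<in> lmeasurable"
    and lim: "((\<lambda>t. t * measure lebesgue (- ball 0 t \<inter> \<Omega>) - G (ln t)) \<longlongrightarrow> 0) at_top"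
    using ex_set_with_lipschitz_profile[OF lip L M] by blast
  \<comment> \<open>The tail has volume \<open>(G (ln t) + o(1)) / t\<close>, so \<open>N + D\<close> must be \<open>-1\<close>.\<close>
  define D where "D = - real CARD('N) - 1"
  define \<epsilon> where "\<epsilon> t = t * measure lebesgue (- ball 0 t \<inter> \<Omega>) - G (ln t)" for t
  have "1 \<le> Liminf at_top (\<lambda>\<tau>. ereal (G \<tau>))"
    using G1 by (intro Liminf_bounded) simp
  then have "0 < Liminf at_top (\<lambda>\<tau>. ereal (G \<tau>))"
    by (rule less_le_trans[rotated]) simp
  moreover have "Liminf at_top (\<lambda>\<tau>. ereal (G \<tau>)) \<le> Limsup at_top (\<lambda>\<tau>. ereal (G \<tau>))"
    by (rule Liminf_le_Limsup) simp
  moreover have "Limsup at_top (\<lambda>\<tau>. ereal (G \<tau>)) \<le> ereal M"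
    using M by (intro Limsup_bounded) simp
  then have "Limsup at_top (\<lambda>\<tau>. ereal (G \<tau>)) < \<infinity>"
    by (rule le_less_trans) simp
  moreover have "\<epsilon> \<in> o[at_top](\<lambda>_. 1)"
    using lim unfolding \<epsilon>_def by (intro smalloI_tendsto) auto
  moreover have "\<forall>\<^sub>F t in at_top. measure lebesgue (- ball 0 t \<inter> \<Omega>)
      = t powr (real CARD('N) + D) * (G (ln t) + \<epsilon> t)"
    using eventually_gt_at_top[of 0]
    by eventually_elim (simp add: D_def \<epsilon>_def powr_minus field_simps)
  moreover have "0 \<le> G \<tau>" for \<tau>
    using G1[of \<tau>] by simp
  moreover have "D \<le> - real CARD('N)"
    by (simp add: D_def)
  ultimately have "at_infinity_with Q \<Omega>"
    using \<Omega> \<open>Q G\<close> unfolding at_infinity_with_def by blast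
  then show ?thesis ..
qed

lemma infinite_at_infinity_with_quasiperiods:
  assumes T: "inj_on T {1..n}" "T ` {1..n} \<subseteq> {0<..}" "rationally_independent (T ` {1..n})"
    and Q: "\<And>G. quasiperiodic_with n T G \<Longrightarrow> Q G"
  shows "infinite {\<Omega> :: (real ^ 'N) set. at_infinity_with Q \<Omega>}"
proof -
  \<comment> \<open>\<open>L\<close> is a Lipschitz constant of the sum of the sines, which itself is at least \<open>-n\<close>; the
    constant term lifts \<open>G\<close> above both \<open>L\<close> and \<open>1\<close>.\<close>
  define L where "L = (\<Sum>k\<in>{1..n}. 2 * pi / T k)"
  define C where "C = L + n + 1"
  define G where "G = (\<lambda>\<tau>::real. sine_sum n T C (\<lambda>k. \<tau>))"
  have "L \<ge> 0"
    unfolding L_def using T(2) by (intro sum_nonneg divide_nonneg_pos) (auto simp: image_subset_iff)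
  have bounds: "L + 1 \<le> G \<tau>" "G \<tau> \<le> L + 2 * n + 1" for \<tau>
    using sine_sum_bounds[of n T C "\<lambda>k. \<tau>"] by (auto simp: G_def C_def abs_le_iff)
  have "\<exists>\<Omega> :: (real ^ 'N) set. at_infinity_with Q \<Omega>"
  proof (rule ex_at_infinity_with_lipschitz)
    show "\<bar>G \<tau> - G \<sigma>\<bar> \<le> L * \<bar>\<tau> - \<sigma>\<bar>" for \<tau> \<sigma>
      unfolding G_def L_def using T(2) by (rule sine_sum_diagonal_lipschitz)
    show "L \<le> G \<tau>" "1 \<le> G \<tau>" "G \<tau> \<le> L + 2 * n + 1" for \<tau>
      using bounds[of \<tau>] \<open>L \<ge> 0\<close> by linarith+
    show "Q G"
      unfolding G_def by (intro Q quasiperiodic_sine_sum T)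
  qed
  then show ?thesis
    using infinite_at_infinity_with by blast
qed

theorem theorem5p8:
  fixes n :: nat
  assumes "n \<ge> 2"
  shows "infinite (D_tqp_infinity n :: (real ^ 'N) set set) \<and>
         infinite (D_aqp_infinity n :: (real ^ 'N) set set)"
proof
  obtain T where T: "inj_on T {1..n}" "T ` {1..n} \<subseteq> {0<..}" "algebraically_independent (T ` {1..n})"
    using ex_algebraically_independent_quasiperiods .
  have "transcendentally_quasiperiodic n G" if "quasiperiodic_with n T G" for G
    using that T(3) unfolding transcendentally_quasiperiodic_def by blast
  then show "infinite (D_tqp_infinity n :: (real ^ 'N) set set)"
    unfolding D_tqp_infinity_def
    by (rule infinite_at_infinity_with_quasiperiods[OF T(1,2)
          algebraically_independent_imp_rationally_independent[OF T(3)]])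
next
  obtain T where T: "inj_on T {1..n}" "T ` {1..n} \<subseteq> {0<..}" "rationally_independent (T ` {1..n})"
    "\<not> algebraically_independent (T ` {1..n})"
    using ex_only_rationally_independent_quasiperiods[OF assms] .
  have "algebraically_quasiperiodic n G" if "quasiperiodic_with n T G" for G
    using that T(4) unfolding algebraically_quasiperiodic_def by blast
  then show "infinite (D_aqp_infinity n :: (real ^ 'N) set set)"
    unfolding D_aqp_infinity_def
    by (rule infinite_at_infinity_with_quasiperiods[OF T(1-3)])
qed

end
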